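(* Let $\rho\in[0,1)$ be irrational and let $n$ be a positive integer. Then: (i) for every $z\in[0,1)$, $\sum_{i\in\mathbb{Z}}\nu(\rho,n,z+i)=1$; (ii) the support of the measure $\nu(\rho,n,z)\,dz$ on $\mathbb{R}$ is a bounded interval.
   Context: $\{t\}=t-\lfloor t\rfloor$ denotes the fractional part of a real number $t$. For $\rho\in\mathbb{R}$, a positive integer $n$, and $x\in[0,1)$ (the model of the circle $\mathbb{R}/\mathbb{Z}$), the Birkhoff sum is $S(\rho,n,x)=\sum_{i=1}^{n}\left(\{x+i\rho\}-\tfrac12\right)$; as a function of $x$ it is piecewise affine with slope $n$ on each piece. The Birkhoff density is $\nu(\rho,n,z)=\frac1n\,\#\{x\in[0,1): S(\rho,n,x)=z\}$ for $z\in\mathbb{R}$; it is the density of the pushforward of Lebesgue measure on $[0,1)$ under $x\mapsto S(\rho,n,x)$. *)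

theory Defs
  imports "HOL-Analysis.Analysis"
begin

definition birkhoff_sum :: "real \<Rightarrow> nat \<Rightarrow> real \<Rightarrow> real" where
  "birkhoff_sum \<rho> n x = (\<Sum>i=1..n. (frac (x + real i * \<rho>) - 1/2))"

(* For n > 0 the counted set is finite (birkhoff_sum \<rho> n is piecewise affine with slope n on
   finitely many pieces), so the convention card A = 0 for infinite A does not interfere. *)
definition birkhoff_density :: "real \<Rightarrow> nat \<Rightarrow> real \<Rightarrow> real" where
  "birkhoff_density \<rho> n z = real (card {x \<in> {0..<1}. birkhoff_sum \<rho> n x = z}) / real n"

definition birkhoff_measure :: "real \<Rightarrow> nat \<Rightarrow> real measure" where
  "birkhoff_measure \<rho> n = density lborel (\<lambda>z. ennreal (birkhoff_density \<rho> n z))"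

(* Topological support: the points all of whose open neighbourhoods have positive measure.
   Intended for Borel measures, where every open set is measurable. *)
definition measure_support :: "'a::topological_space measure \<Rightarrow> 'a set" where
  "measure_support M = {x. \<forall>U. open U \<longrightarrow> x \<in> U \<longrightarrow> emeasure M U > 0}"

end

theory Submission
  imports Defs
begin

text \<open>Modulo 1 the Birkhoff sum is \<open>n x + c\<close> for a constant \<open>c\<close>, so a level \<open>z\<close> can only be attained
  at the \<open>n\<close> points \<open>x\<close> of \<open>[0,1)\<close> with \<open>n x \<equiv> z - c\<close> modulo 1. These points depend only on \<open>z\<close>
  modulo 1, and each of them is mapped to exactly one translate \<open>z + i\<close>; this gives (i), as well as
  the measurability of the density.
  For (ii), the Birkhoff sum is 1-periodic and all its jumps are downwards, so it cannot pass from
  below a level to above it without attaining it. Hence its range is an interval, and the support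
  is the closure of the range.\<close>

section \<open>Intermediate values, supports of densities, sums of families\<close>

text \<open>The bound restricts only growth to the right, so \<open>f\<close> may jump down but
  cannot jump up over \<open>w\<close>. Hence the infimum of the points of \<open>{a..b}\<close>
  where \<open>f\<close> is at least \<open>w\<close> has the value \<open>w\<close>.\<close>

lemma ivt_one_sided_Lipschitz:
  fixes f :: "real \<Rightarrow> real"
  assumes L: "\<And>s t. s \<le> t \<Longrightarrow> f t \<le> f s + L * (t - s)"
    and "0 < L" "a \<le> b" "f a \<le> w" "w \<le> f b"
  shows "\<exists>t. f t = w"
proof -
  define A where "A = {s \<in> {a..b}. w \<le> f s}"
  define t where "t = Inf A"
  have "b \<in> A" using assms by (simp add: A_def)
  have bdd: "bdd_below A" by (auto simp: A_def bdd_below_def)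
  have "t \<ge> a" unfolding t_def using \<open>b \<in> A\<close> by (intro cInf_greatest) (auto simp: A_def)
  have "t \<le> b" unfolding t_def using \<open>b \<in> A\<close> bdd by (rule cInf_lower)
  \<comment> \<open>Points of \<open>A\<close> come arbitrarily close to \<open>t\<close> from the
    right, and from \<open>t\<close> to such a point \<open>f\<close> gains at most
    \<open>e\<close>.\<close>
  have "f t \<ge> w"
  proof (rule field_le_epsilon)
    fix e :: real assume "e > 0"
    then obtain s where s: "s \<in> A" "s < t + e / L"
      using cInf_lessD[of A "t + e / L"] \<open>b \<in> A\<close> \<open>0 < L\<close> by (auto simp: t_def)
    have "t \<le> s" unfolding t_def using s(1) bdd by (rule cInf_lower)
    then have "w \<le> f t + L * (s - t)" using L[of t s] s by (auto simp: A_def)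
    also have "L * (s - t) \<le> e" using s(2) \<open>0 < L\<close> by (simp add: field_simps)
    finally show "w \<le> f t + e" by simp
  qed
  moreover have "f t \<le> w"
  proof (cases "t = a")
    case False
    show ?thesis
    proof (rule field_le_epsilon)
      fix e :: real assume "e > 0"
      \<comment> \<open>The \<open>max\<close> keeps \<open>s\<close> in \<open>{a..b}\<close>;
        being left of the infimum, \<open>s\<close> lies outside \<open>A\<close>, and from
        \<open>s\<close> to \<open>t\<close> the gain is at most \<open>e\<close>.\<close>
      define s where "s = max a (t - e / L)"
      have s: "a \<le> s" "s < t" "t - s \<le> e / L"
        using False \<open>t \<ge> a\<close> \<open>e > 0\<close> \<open>0 < L\<close> by (auto simp: s_def)
      have "s \<notin> A" using cInf_lower[OF _ bdd, of s] s by (auto simp: t_def)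
      then have "f s < w" using s \<open>t \<le> b\<close> by (auto simp: A_def)
      moreover have "L * (t - s) \<le> e" using s(3) \<open>0 < L\<close> by (simp add: field_simps)
      ultimately show "f t \<le> w + e" using L[of s t] s by linarith
    qed
  qed (use assms in simp)
  ultimately show ?thesis by (intro exI[of _ t]) simp
qed

text \<open>A convex set with interior points lies in the closure of its interior. So each
  neighbourhood of a point of the closure contains a nonempty open set on which \<open>f\<close> is
  nonzero, and such a set is not Lebesgue null.\<close>

lemma measure_support_density_lborel:
  fixes f :: "'a::euclidean_space \<Rightarrow> ennreal"
  assumes [measurable]: "f \<in> borel_measurable borel"
    and "convex {x. f x \<noteq> 0}" "interior {x. f x \<noteq> 0} \<noteq> {}"
  shows "measure_support (density lborel f) = closure {x. f x \<noteq> 0}"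
proof (rule equalityI; rule subsetI)
  let ?R = "{x. f x \<noteq> 0}"
  fix x assume "x \<in> measure_support (density lborel f)"
  moreover have "- closure ?R \<in> null_sets (density lborel f)"
    using closure_subset[of ?R] by (subst null_sets_density_iff) auto
  ultimately show "x \<in> closure ?R"
    unfolding measure_support_def
    by (auto dest!: spec[of _ "- closure ?R"] simp: null_setsD1)
next
  let ?R = "{x. f x \<noteq> 0}"
  fix x assume "x \<in> closure ?R"
  then have x: "x \<in> closure (interior ?R)"
    using convex_closure_interior assms by blast
  have False if U: "open U" "x \<in> U" "emeasure (density lborel f) U = 0" for U
  proof -
    have [measurable]: "U \<in> sets borel" using U by simp
    let ?V = "U \<inter> interior ?R"
    have V: "open ?V" "?V \<noteq> {}" using U x open_Int_closure_eq_empty[OF U(1)] by blast+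
    have "U \<in> null_sets (density lborel f)" using U by (simp add: null_sets_def)
    then have "AE y in lborel. y \<in> U \<longrightarrow> f y = 0" by (subst (asm) null_sets_density_iff) auto
    then have "AE y in lborel. y \<notin> ?V"
      by eventually_elim (use interior_subset[of ?R] in auto)
    then have "?V \<in> null_sets lborel" using V by (subst AE_iff_null_sets) auto
    then have "negligible ?V" by (simp add: negligible_iff_null_sets null_sets_completionI)
    then show False using V open_not_negligible by blast
  qed
  then show "x \<in> measure_support (density lborel f)"
    by (auto simp: measure_support_def zero_less_iff_neq_zero)
qed

lemma has_sum_finite_sum:
  fixes f :: "'i \<Rightarrow> 'a \<Rightarrow> 'b::topological_comm_monoid_add"
  assumes "\<And>i. (f i has_sum s i) A"
  shows "((\<lambda>x. \<Sum>i\<in>I. f i x) has_sum (\<Sum>i\<in>I. s i)) A"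
  \<comment> \<open>An infinite \<open>I\<close> is covered because both sums over it are 0 by
    convention.\<close>
  by (induction I rule: infinite_finite_induct) (auto intro: has_sum_add assms)

section \<open>The Birkhoff sum: downward jumps, periodicity, range\<close>

definition birkhoff_const :: "real \<Rightarrow> nat \<Rightarrow> real" where
  "birkhoff_const \<rho> n = (\<Sum>i=1..n. real i * \<rho> - 1/2)"

lemma birkhoff_sum_eq:
  "birkhoff_sum \<rho> n x = real n * x + birkhoff_const \<rho> n - of_int (\<Sum>i=1..n. \<lfloor>x + real i * \<rho>\<rfloor>)"
  by (simp add: birkhoff_sum_def birkhoff_const_def frac_def sum.distrib sum_subtractf)

text \<open>The floors are monotone and enter with a minus sign, so only the linear part can
  increase the sum.\<close>

lemma birkhoff_sum_one_sided_Lipschitz: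
  assumes "s \<le> t"
  shows "birkhoff_sum \<rho> n t \<le> birkhoff_sum \<rho> n s + real n * (t - s)"
proof -
  have "(\<Sum>i=1..n. \<lfloor>s + real i * \<rho>\<rfloor>) \<le> (\<Sum>i=1..n. \<lfloor>t + real i * \<rho>\<rfloor>)"
    using assms by (intro sum_mono floor_mono) simp
  then have "real_of_int (\<Sum>i=1..n. \<lfloor>s + real i * \<rho>\<rfloor>) \<le> of_int (\<Sum>i=1..n. \<lfloor>t + real i * \<rho>\<rfloor>)"
    by (rule of_int_le_iff[THEN iffD2])
  then show ?thesis unfolding birkhoff_sum_eq right_diff_distrib by linarith
qed

lemma birkhoff_sum_add_int: "birkhoff_sum \<rho> n (x + of_int k) = birkhoff_sum \<rho> n x"
proof -
  have "frac (x + of_int k + real i * \<rho>) = frac (x + real i * \<rho>)" for i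
    using frac_add_of_int_right[of "x + real i * \<rho>" k] by (simp add: add_ac)
  then show ?thesis by (simp add: birkhoff_sum_def)
qed

lemma birkhoff_sum_frac: "birkhoff_sum \<rho> n (frac x) = birkhoff_sum \<rho> n x"
  using birkhoff_sum_add_int[of \<rho> n x "- \<lfloor>x\<rfloor>"] by (simp add: frac_def)

lemma abs_birkhoff_sum_le: "\<bar>birkhoff_sum \<rho> n x\<bar> \<le> real n"
proof -
  have "\<bar>frac (x + real i * \<rho>) - 1/2\<bar> \<le> 1" for i
    using frac_ge_0[of "x + real i * \<rho>"] frac_lt_1[of "x + real i * \<rho>"] by linarith
  then show ?thesis
    unfolding birkhoff_sum_def
    by (intro order_trans[OF sum_abs] order_trans[OF sum_bounded_above[of _ _ 1]]) auto
qed

lemma convex_range_birkhoff_sum: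
  assumes "n > 0"
  shows "convex (range (birkhoff_sum \<rho> n))"
  unfolding is_interval_convex_1[symmetric] is_interval_1
proof (intro ballI allI impI)
  fix u v w
  assume u: "u \<in> range (birkhoff_sum \<rho> n)" and v: "v \<in> range (birkhoff_sum \<rho> n)"
    and w: "u \<le> w \<and> w \<le> v"
  from u v obtain x y where xy: "u = birkhoff_sum \<rho> n x" "v = birkhoff_sum \<rho> n y" by auto
  \<comment> \<open>Upward passage is controlled only from left to right; periodicity allows moving
    \<open>y\<close> to the right of \<open>x\<close> without changing the value there.\<close>
  have "x \<le> y + of_int \<lceil>x - y\<rceil>" by linarith
  then have "\<exists>t. birkhoff_sum \<rho> n t = w"
    using xy w assms
    by (intro ivt_one_sided_Lipschitz[where L = "real n" and a = x and b = "y + of_int \<lceil>x - y\<rceil>"]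
          birkhoff_sum_one_sided_Lipschitz) (auto simp: birkhoff_sum_add_int)
  then show "w \<in> range (birkhoff_sum \<rho> n)" by auto
qed

section \<open>Level sets and the density\<close>

text \<open>For \<open>k < n\<close> these are the solutions in \<open>{0..<1}\<close> of
  \<open>n x = z - birkhoff_const \<rho> n\<close> modulo 1. Taking \<open>frac\<close> makes them
  invariant under integer shifts of \<open>z\<close>.\<close>

definition level_point :: "real \<Rightarrow> nat \<Rightarrow> real \<Rightarrow> nat \<Rightarrow> real" where
  "level_point \<rho> n z k = (frac (z - birkhoff_const \<rho> n) + real k) / real n"

lemma level_point_in: "k < n \<Longrightarrow> level_point \<rho> n z k \<in> {0..<1}"
  using frac_lt_1[of "z - birkhoff_const \<rho> n"] by (auto simp: level_point_def)

lemma inj_level_point: "n > 0 \<Longrightarrow> inj (level_point \<rho> n z)"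
  by (auto simp: level_point_def inj_def)

lemma level_point_add_int: "level_point \<rho> n (z + of_int i) k = level_point \<rho> n z k"
  using frac_add_of_int_right[of "z - birkhoff_const \<rho> n" i]
  by (simp add: level_point_def algebra_simps)

lemma birkhoff_sum_level_point:
  assumes "n > 0"
  shows "\<exists>i::int. birkhoff_sum \<rho> n (level_point \<rho> n z k) = z + of_int i"
proof
  show "birkhoff_sum \<rho> n (level_point \<rho> n z k) = z + of_int (int k - \<lfloor>z - birkhoff_const \<rho> n\<rfloor>
    - (\<Sum>i=1..n. \<lfloor>level_point \<rho> n z k + real i * \<rho>\<rfloor>))"
    using assms by (subst birkhoff_sum_eq) (simp add: level_point_def frac_def)
qed

lemma level_set_subset:
  assumes "n > 0" "x \<in> {0..<1}" "birkhoff_sum \<rho> n x = z"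
  shows "\<exists>k<n. x = level_point \<rho> n z k"
proof -
  let ?c = "birkhoff_const \<rho> n"
  \<comment> \<open>This is the integer part of \<open>n x\<close>, so \<open>x\<close> in
    \<open>{0..<1}\<close> forces it into the index range of the level points.\<close>
  define j where "j = \<lfloor>z - ?c\<rfloor> + (\<Sum>i=1..n. \<lfloor>x + real i * \<rho>\<rfloor>)"
  have nx: "real n * x = frac (z - ?c) + of_int j"
    using assms(3) unfolding birkhoff_sum_eq j_def frac_def by simp
  have "0 \<le> real n * x" "real n * x < real n" using assms by auto
  then have "0 \<le> j" "j < int n"
    using frac_lt_1[of "z - ?c"] frac_ge_0[of "z - ?c"] unfolding nx by linarith+
  moreover have "x = level_point \<rho> n z (nat j)"
    using nx assms(1) \<open>0 \<le> j\<close> by (simp add: level_point_def field_simps)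
  ultimately show ?thesis by (intro exI[of _ "nat j"]) auto
qed

lemma level_set_eq:
  assumes "n > 0"
  shows "{x \<in> {0..<1}. birkhoff_sum \<rho> n x = z} =
    level_point \<rho> n z ` {k. k < n \<and> birkhoff_sum \<rho> n (level_point \<rho> n z k) = z}"
proof (intro equalityI subsetI)
  fix x assume x: "x \<in> {x \<in> {0..<1}. birkhoff_sum \<rho> n x = z}"
  with level_set_subset[OF assms] obtain k where "k < n" "x = level_point \<rho> n z k" by blast
  with x show "x \<in> level_point \<rho> n z ` {k. k < n \<and> birkhoff_sum \<rho> n (level_point \<rho> n z k) = z}"
    by auto
qed (use level_point_in in auto)

text \<open>Counting indices instead of points turns the density into a finite sum of indicators,
  which is visibly Borel in \<open>z\<close> and can be summed over translates term by term.\<close>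

lemma birkhoff_density_eq_sum:
  assumes "n > 0"
  shows "birkhoff_density \<rho> n z =
    (\<Sum>k<n. if birkhoff_sum \<rho> n (level_point \<rho> n z k) = z then 1 else 0) / real n"
proof -
  have "card {x \<in> {0..<1}. birkhoff_sum \<rho> n x = z} =
      card {k. k < n \<and> birkhoff_sum \<rho> n (level_point \<rho> n z k) = z}"
    unfolding level_set_eq[OF assms]
    by (intro card_image inj_on_subset[OF inj_level_point[OF assms]]) auto
  moreover have "{k. k < n \<and> birkhoff_sum \<rho> n (level_point \<rho> n z k) = z} =
      {..<n} \<inter> {k. birkhoff_sum \<rho> n (level_point \<rho> n z k) = z}" by auto
  ultimately show ?thesis
    by (simp add: birkhoff_density_def sum.If_cases)
qed

lemma birkhoff_density_pos_iff:
  assumes "n > 0"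
  shows "birkhoff_density \<rho> n z > 0 \<longleftrightarrow> z \<in> range (birkhoff_sum \<rho> n)"
proof -
  \<comment> \<open>Since \<open>card\<close> is 0 on infinite sets, finiteness is what makes a
    nonempty level set count positively.\<close>
  have "finite {x \<in> {0..<1}. birkhoff_sum \<rho> n x = z}"
    unfolding level_set_eq[OF assms] by simp
  then have "birkhoff_density \<rho> n z > 0 \<longleftrightarrow> (\<exists>x\<in>{0..<1}. birkhoff_sum \<rho> n x = z)"
    using assms by (simp add: birkhoff_density_def zero_less_divide_iff card_gt_0_iff) auto
  also have "\<dots> \<longleftrightarrow> z \<in> range (birkhoff_sum \<rho> n)"
  proof
    assume "z \<in> range (birkhoff_sum \<rho> n)"
    then obtain x where "z = birkhoff_sum \<rho> n x" by auto
    then show "\<exists>x\<in>{0..<1}. birkhoff_sum \<rho> n x = z"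
      by (intro bexI[of _ "frac x"]) (auto simp: birkhoff_sum_frac frac_lt_1)
  qed auto
  finally show ?thesis .
qed

lemma birkhoff_density_measurable:
  assumes "n > 0"
  shows "birkhoff_density \<rho> n \<in> borel_measurable borel"
  unfolding birkhoff_density_eq_sum[OF assms, abs_def] level_point_def birkhoff_sum_def frac_def
  by measurable

lemma birkhoff_density_has_sum:
  assumes "n > 0"
  shows "((\<lambda>i::int. birkhoff_density \<rho> n (z + of_int i)) has_sum 1) UNIV"
proof -
  \<comment> \<open>For a fixed index \<open>k\<close> exactly one translate is hit, so the sum over
    \<open>i\<close> has a single nonzero term.\<close>
  have "((\<lambda>i::int. if birkhoff_sum \<rho> n (level_point \<rho> n z k) = z + of_int i then 1 else 0 :: real)
      has_sum 1) UNIV" for k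
  proof -
    obtain j :: int where "birkhoff_sum \<rho> n (level_point \<rho> n z k) = z + of_int j"
      using birkhoff_sum_level_point[OF assms] by blast
    then have "((\<lambda>i::int. if birkhoff_sum \<rho> n (level_point \<rho> n z k) = z + of_int i then 1 else 0 :: real)
        has_sum 1) {j}"
      by (simp add: has_sum_finite_iff)
    then show ?thesis
      by (rule has_sum_cong_neutral[THEN iffD1, rotated -1])
        (auto simp: \<open>birkhoff_sum \<rho> n (level_point \<rho> n z k) = z + of_int j\<close>)
  qed
  then have "((\<lambda>i::int. \<Sum>k<n. if birkhoff_sum \<rho> n (level_point \<rho> n z k) = z + of_int i
      then 1 else 0 :: real) has_sum (\<Sum>k<n. 1)) UNIV"
    by (rule has_sum_finite_sum)
  \<comment> \<open>All translates share the level points of \<open>z\<close>, so the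
    \<open>n\<close> unit sums, weighted by \<open>1 / n\<close>, give 1.\<close>
  from has_sum_cmult_right[OF this, of "1 / real n"] show ?thesis
    using assms by (simp add: birkhoff_density_eq_sum level_point_add_int)
qed

section \<open>The support\<close>

lemma interior_range_birkhoff_sum:
  assumes "n > 0"
  shows "interior (range (birkhoff_sum \<rho> n)) \<noteq> {}"
proof -
  \<comment> \<open>The levels 0 and 1/2 are both attained modulo 1. An integer and a half-integer
    differ, so the convex range contains a nondegenerate interval.\<close>
  obtain i j :: int where
    "birkhoff_sum \<rho> n (level_point \<rho> n 0 0) = 0 + of_int i"
    "birkhoff_sum \<rho> n (level_point \<rho> n (1/2) 0) = 1/2 + of_int j"
    using birkhoff_sum_level_point[OF assms] by meson
  then have ij: "of_int i \<in> range (birkhoff_sum \<rho> n)" "1/2 + of_int j \<in> range (birkhoff_sum \<rho> n)"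
    by (metis add_0 rangeI)+
  define a b where "a = min (real_of_int i) (1/2 + of_int j)"
    and "b = max (real_of_int i) (1/2 + of_int j)"
  have "2 * i \<noteq> 1 + 2 * j" by presburger
  then have "real_of_int (2 * i) \<noteq> of_int (1 + 2 * j)" by (subst of_int_eq_iff)
  then have "a < b" by (auto simp: a_def b_def min_def max_def)
  have "a \<in> range (birkhoff_sum \<rho> n)" "b \<in> range (birkhoff_sum \<rho> n)"
    using ij by (auto simp: a_def b_def min_def max_def)
  then have "{a..b} \<subseteq> range (birkhoff_sum \<rho> n)"
    using convex_range_birkhoff_sum[OF assms, of \<rho>]
    unfolding is_interval_convex_1[symmetric] is_interval_1 by (meson atLeastAtMost_iff subsetI)
  then have "{a<..<b} \<subseteq> interior (range (birkhoff_sum \<rho> n))"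
    by (intro interior_maximal) auto
  moreover have "{a<..<b} \<noteq> {}" using \<open>a < b\<close> by simp
  ultimately show ?thesis by blast
qed

lemma measure_support_birkhoff_measure:
  assumes "n > 0"
  shows "measure_support (birkhoff_measure \<rho> n) = closure (range (birkhoff_sum \<rho> n))"
proof -
  have "{z. ennreal (birkhoff_density \<rho> n z) \<noteq> 0} = range (birkhoff_sum \<rho> n)"
    using birkhoff_density_pos_iff[OF assms, of \<rho>]
    by (auto simp: ennreal_eq_0_iff not_le)
  then show ?thesis
    unfolding birkhoff_measure_def
    using measure_support_density_lborel[of "\<lambda>z. ennreal (birkhoff_density \<rho> n z)"]
      birkhoff_density_measurable[OF assms] convex_range_birkhoff_sum[OF assms]
      interior_range_birkhoff_sum[OF assms] by simp
qed

theorem theorem2p2: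
  fixes \<rho> :: real and n :: nat
  assumes "\<rho> \<in> {0..<1}" and "\<rho> \<notin> \<rat>" and "n > 0"
  shows "(\<forall>z\<in>{0..<1}. ((\<lambda>i::int. birkhoff_density \<rho> n (z + of_int i)) has_sum 1) UNIV) \<and>
         (let S = measure_support (birkhoff_measure \<rho> n) in
            S \<noteq> {} \<and> is_interval S \<and> bounded S)"
proof -
  have "bounded (range (birkhoff_sum \<rho> n))"
    using abs_birkhoff_sum_le by (auto intro!: boundedI)
  \<comment> \<open>Closure keeps the range nonempty, convex and bounded, and on the line convex
    sets are intervals.\<close>
  then show ?thesis
    using birkhoff_density_has_sum[OF assms(3)] convex_range_birkhoff_sum[OF assms(3)]
    by (simp add: measure_support_birkhoff_measure[OF assms(3)] Let_def is_interval_convex_1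
        convex_closure bounded_closure)
qed

end
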